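(* Let $\mathbf{E},\mathbf{A}\in\mathbb{R}^{n\times n}$, $\mathbf{B}\in\mathbb{R}^{n\times 1}$, $\mathbf{C}\in\mathbb{R}^{1\times n}$, with $\mathbf{E}$ nonsingular and all eigenvalues of the pencil $\lambda\mathbf{E}-\mathbf{A}$ in the open left half-plane. Let $\omega_1,\dots,\omega_{N_q}\in\mathbb{R}$ and $\phi_1,\dots,\phi_{N_q}\in\mathbb{R}$ (quadrature nodes $\dot\imath\omega_\ell$ and weights $\phi_\ell^2$), and let $\eta_1^{(k)},\ldots,\eta_r^{(k)}\in\mathbb{C}$ be the shifts at step $k$ of the iteration, none of which is an eigenvalue of $\lambda\mathbf{E}-\mathbf{A}$. Let $\mathbf{V}_r^{(k)}$, $\widetilde{\mathbf{W}}_r^{(k)}$, $\widetilde{\mathbb{L}}^{(k)}$, $\widetilde{\mathbb{M}}^{(k)}$, $\widetilde{\mathbb{V}}$, $\widetilde{\mathbb{W}}$ be as defined in the context. Then the reduced-order matrices at step $k$, $$\widetilde{\mathbf{A}}_r^{(k)}=\left[\widetilde{\mathbf{W}}_r^{(k)}\right]^*\mathbf{A}\mathbf{V}_r^{(k)},\quad \widetilde{\mathbf{E}}_r^{(k)}=\left[\widetilde{\mathbf{W}}_r^{(k)}\right]^*\mathbf{E}\mathbf{V}_r^{(k)},\quad \widetilde{\mathbf{B}}_r^{(k)}=\left[\widetilde{\mathbf{W}}_r^{(k)}\right]^*\mathbf{B},\quad \widetilde{\mathbf{C}}_r^{(k)}=\mathbf{C}\mathbf{V}_r^{(k)},$$ are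 expressed solely in terms of $\widetilde{\mathbb{L}}^{(k)},\widetilde{\mathbb{M}}^{(k)},\widetilde{\mathbb{V}},\widetilde{\mathbb{W}}$; explicitly, $$\widetilde{\mathbf{A}}_r^{(k)}=\left[\widetilde{\mathbb{L}}^{(k)}\right]^*\widetilde{\mathbb{M}}^{(k)},\quad \widetilde{\mathbf{E}}_r^{(k)}=\left[\widetilde{\mathbb{L}}^{(k)}\right]^*\widetilde{\mathbb{L}}^{(k)},\quad \widetilde{\mathbf{B}}_r^{(k)}=\left[\widetilde{\mathbb{L}}^{(k)}\right]^*\widetilde{\mathbb{V}},\quad \widetilde{\mathbf{C}}_r^{(k)}=\widetilde{\mathbb{W}}.$$
   Context: Here $\dot\imath$ is the imaginary unit and $(\cdot)^*$ is the conjugate transpose. Define $\widetilde{\mathbf{L}}\in\mathbb{C}^{n\times N_q}$ by $$\widetilde{\mathbf{L}}^*=\begin{bmatrix}\phi_1\mathbf{C}(\dot\imath\omega_1\mathbf{E}-\mathbf{A})^{-1}\\ \vdots\\ \phi_{N_q}\mathbf{C}(\dot\imath\omega_{N_q}\mathbf{E}-\mathbf{A})^{-1}\end{bmatrix}\in\mathbb{C}^{N_q\times n},$$ and the quadrature-based approximation $$\widetilde{\mathbf{Q}}=\widetilde{\mathbf{L}}\widetilde{\mathbf{L}}^*=\sum_{\ell=1}^{N_q}\phi_\ell^2(-\dot\imath\omega_\ell\mathbf{E}^T-\mathbf{A}^T)^{-1}\mathbf{C}^T\mathbf{C}(\dot\imath\omega_\ell\mathbf{E}-\mathbf{A})^{-1}.$$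 The projection matrices at step $k$ are $$\mathbf{V}_r^{(k)}=\begin{bmatrix}(\eta_1^{(k)}\mathbf{E}-\mathbf{A})^{-1}\mathbf{B}&\cdots&(\eta_r^{(k)}\mathbf{E}-\mathbf{A})^{-1}\mathbf{B}\end{bmatrix}\in\mathbb{C}^{n\times r},\qquad \widetilde{\mathbf{W}}_r^{(k)}=\widetilde{\mathbf{Q}}\mathbf{E}\mathbf{V}_r^{(k)}=\widetilde{\mathbf{L}}\widetilde{\mathbf{L}}^*\mathbf{E}\mathbf{V}_r^{(k)}\in\mathbb{C}^{n\times r}.$$ The data matrices and vectors are $$\widetilde{\mathbb{L}}^{(k)}=\widetilde{\mathbf{L}}^*\mathbf{E}\mathbf{V}_r^{(k)}\in\mathbb{C}^{N_q\times r},\quad \widetilde{\mathbb{M}}^{(k)}=\widetilde{\mathbf{L}}^*\mathbf{A}\mathbf{V}_r^{(k)}\in\mathbb{C}^{N_q\times r},\quad \widetilde{\mathbb{V}}=\widetilde{\mathbf{L}}^*\mathbf{B}\in\mathbb{C}^{N_q\times 1},\quad \widetilde{\mathbb{W}}=\mathbf{C}\mathbf{V}_r^{(k)}\in\mathbb{C}^{1\times r}.$$ *)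

theory Defs
  imports "HOL-Analysis.Analysis"
begin

text \<open>
  Matrices with \<open>p\<close> rows and \<open>q\<close> columns have type \<open>'a ^ 'q ^ 'p\<close>. The index types \<open>'n\<close>, \<open>'q\<close>
  and \<open>'r\<close> stand for the state dimension $n$, the number of quadrature nodes $N_q$ and the
  reduced order $r$. Real matrices are embedded into the complex ones explicitly.
\<close>

abbreviation cmat :: "real ^ 'm ^ 'l \<Rightarrow> complex ^ 'm ^ 'l"
  where "cmat \<equiv> map_matrix complex_of_real"

definition ctranspose :: "complex ^ 'm ^ 'l \<Rightarrow> complex ^ 'l ^ 'm"
  where "ctranspose M = map_matrix cnj (transpose M)"

definition pencil :: "real ^ 'n ^ 'n \<Rightarrow> real ^ 'n ^ 'n \<Rightarrow> complex \<Rightarrow> complex ^ 'n ^ 'n"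
  where "pencil E A z = map_matrix (\<lambda>x. z * complex_of_real x) E - cmat A"

text \<open>Only finite eigenvalues occur, because \<open>E\<close> is assumed to be nonsingular.\<close>

definition pencil_eigenvalue :: "real ^ 'n ^ 'n \<Rightarrow> real ^ 'n ^ 'n \<Rightarrow> complex \<Rightarrow> bool"
  where "pencil_eigenvalue E A z \<longleftrightarrow> (\<exists>x. x \<noteq> 0 \<and> cmat A *v x = z *s (cmat E *v x))"

text \<open>
  \<open>matrix_inv\<close> is unspecified on singular matrices. It is only applied to \<open>pencil E A z\<close>
  for \<open>z\<close> that is not an eigenvalue; lemma \<open>invertible_pencil\<close> below shows that this is enough.
\<close>

definition quad_Lstar ::
  "real ^ 'n ^ 'n \<Rightarrow> real ^ 'n ^ 'n \<Rightarrow> real ^ 'n ^ 1 \<Rightarrow> ('q::finite \<Rightarrow> real) \<Rightarrow> ('q \<Rightarrow> real) \<Rightarrow> complex ^ 'n ^ 'q"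
  where "quad_Lstar E A C \<omega> \<phi> =
    (\<chi> l. row 1 (\<phi> l *\<^sub>R (cmat C ** matrix_inv (pencil E A (\<i> * complex_of_real (\<omega> l))))))"

definition quad_L ::
  "real ^ 'n ^ 'n \<Rightarrow> real ^ 'n ^ 'n \<Rightarrow> real ^ 'n ^ 1 \<Rightarrow> ('q::finite \<Rightarrow> real) \<Rightarrow> ('q \<Rightarrow> real) \<Rightarrow> complex ^ 'q ^ 'n"
  where "quad_L E A C \<omega> \<phi> = ctranspose (quad_Lstar E A C \<omega> \<phi>)"

text \<open>The expression as a weighted sum over the nodes is lemma \<open>quad_Q_eq_sum\<close> below.\<close>

definition quad_Q ::
  "real ^ 'n ^ 'n \<Rightarrow> real ^ 'n ^ 'n \<Rightarrow> real ^ 'n ^ 1 \<Rightarrow> ('q::finite \<Rightarrow> real) \<Rightarrow> ('q \<Rightarrow> real) \<Rightarrow> complex ^ 'n ^ 'n"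
  where "quad_Q E A C \<omega> \<phi> = quad_L E A C \<omega> \<phi> ** ctranspose (quad_L E A C \<omega> \<phi>)"

definition proj_V ::
  "real ^ 'n ^ 'n \<Rightarrow> real ^ 'n ^ 'n \<Rightarrow> real ^ 1 ^ 'n \<Rightarrow> ('r::finite \<Rightarrow> complex) \<Rightarrow> complex ^ 'r ^ 'n"
  where "proj_V E A B \<eta> = (\<chi> i j. column 1 (matrix_inv (pencil E A (\<eta> j)) ** cmat B) $ i)"

definition proj_W ::
  "real ^ 'n ^ 'n \<Rightarrow> real ^ 'n ^ 'n \<Rightarrow> real ^ 1 ^ 'n \<Rightarrow> real ^ 'n ^ 1 \<Rightarrow>
   ('q::finite \<Rightarrow> real) \<Rightarrow> ('q \<Rightarrow> real) \<Rightarrow> ('r::finite \<Rightarrow> complex) \<Rightarrow> complex ^ 'r ^ 'n"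
  where "proj_W E A B C \<omega> \<phi> \<eta> = quad_Q E A C \<omega> \<phi> ** cmat E ** proj_V E A B \<eta>"

definition data_L ::
  "real ^ 'n ^ 'n \<Rightarrow> real ^ 'n ^ 'n \<Rightarrow> real ^ 1 ^ 'n \<Rightarrow> real ^ 'n ^ 1 \<Rightarrow>
   ('q::finite \<Rightarrow> real) \<Rightarrow> ('q \<Rightarrow> real) \<Rightarrow> ('r::finite \<Rightarrow> complex) \<Rightarrow> complex ^ 'r ^ 'q"
  where "data_L E A B C \<omega> \<phi> \<eta> = ctranspose (quad_L E A C \<omega> \<phi>) ** cmat E ** proj_V E A B \<eta>"

definition data_M ::
  "real ^ 'n ^ 'n \<Rightarrow> real ^ 'n ^ 'n \<Rightarrow> real ^ 1 ^ 'n \<Rightarrow> real ^ 'n ^ 1 \<Rightarrow>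
   ('q::finite \<Rightarrow> real) \<Rightarrow> ('q \<Rightarrow> real) \<Rightarrow> ('r::finite \<Rightarrow> complex) \<Rightarrow> complex ^ 'r ^ 'q"
  where "data_M E A B C \<omega> \<phi> \<eta> = ctranspose (quad_L E A C \<omega> \<phi>) ** cmat A ** proj_V E A B \<eta>"

definition data_V ::
  "real ^ 'n ^ 'n \<Rightarrow> real ^ 'n ^ 'n \<Rightarrow> real ^ 1 ^ 'n \<Rightarrow> real ^ 'n ^ 1 \<Rightarrow>
   ('q::finite \<Rightarrow> real) \<Rightarrow> ('q \<Rightarrow> real) \<Rightarrow> complex ^ 1 ^ 'q"
  where "data_V E A B C \<omega> \<phi> = ctranspose (quad_L E A C \<omega> \<phi>) ** cmat B"

definition data_W ::
  "real ^ 'n ^ 'n \<Rightarrow> real ^ 'n ^ 'n \<Rightarrow> real ^ 1 ^ 'n \<Rightarrow> real ^ 'n ^ 1 \<Rightarrow>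
   ('r::finite \<Rightarrow> complex) \<Rightarrow> complex ^ 'r ^ 1"
  where "data_W E A B C \<eta> = cmat C ** proj_V E A B \<eta>"

definition reduced_A ::
  "real ^ 'n ^ 'n \<Rightarrow> real ^ 'n ^ 'n \<Rightarrow> real ^ 1 ^ 'n \<Rightarrow> real ^ 'n ^ 1 \<Rightarrow>
   ('q::finite \<Rightarrow> real) \<Rightarrow> ('q \<Rightarrow> real) \<Rightarrow> ('r::finite \<Rightarrow> complex) \<Rightarrow> complex ^ 'r ^ 'r"
  where "reduced_A E A B C \<omega> \<phi> \<eta> =
    ctranspose (proj_W E A B C \<omega> \<phi> \<eta>) ** cmat A ** proj_V E A B \<eta>"

definition reduced_E ::
  "real ^ 'n ^ 'n \<Rightarrow> real ^ 'n ^ 'n \<Rightarrow> real ^ 1 ^ 'n \<Rightarrow> real ^ 'n ^ 1 \<Rightarrow>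
   ('q::finite \<Rightarrow> real) \<Rightarrow> ('q \<Rightarrow> real) \<Rightarrow> ('r::finite \<Rightarrow> complex) \<Rightarrow> complex ^ 'r ^ 'r"
  where "reduced_E E A B C \<omega> \<phi> \<eta> =
    ctranspose (proj_W E A B C \<omega> \<phi> \<eta>) ** cmat E ** proj_V E A B \<eta>"

definition reduced_B ::
  "real ^ 'n ^ 'n \<Rightarrow> real ^ 'n ^ 'n \<Rightarrow> real ^ 1 ^ 'n \<Rightarrow> real ^ 'n ^ 1 \<Rightarrow>
   ('q::finite \<Rightarrow> real) \<Rightarrow> ('q \<Rightarrow> real) \<Rightarrow> ('r::finite \<Rightarrow> complex) \<Rightarrow> complex ^ 1 ^ 'r"
  where "reduced_B E A B C \<omega> \<phi> \<eta> = ctranspose (proj_W E A B C \<omega> \<phi> \<eta>) ** cmat B"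

definition reduced_C ::
  "real ^ 'n ^ 'n \<Rightarrow> real ^ 'n ^ 'n \<Rightarrow> real ^ 1 ^ 'n \<Rightarrow> real ^ 'n ^ 1 \<Rightarrow>
   ('r::finite \<Rightarrow> complex) \<Rightarrow> complex ^ 'r ^ 1"
  where "reduced_C E A B C \<eta> = cmat C ** proj_V E A B \<eta>"

lemma pencil_mult_vector: "pencil E A z *v x = z *s (cmat E *v x) - cmat A *v x"
  by (simp add: vec_eq_iff pencil_def matrix_vector_mult_def vector_scalar_mult_def
      sum_distrib_left left_diff_distrib sum_subtractf mult.assoc)

lemma invertible_pencil:
  assumes "\<not> pencil_eigenvalue E A z"
  shows "invertible (pencil E A z)"
proof -
  have "x = 0" if "pencil E A z *v x = 0" for x
    using assms that by (auto simp: pencil_mult_vector pencil_eigenvalue_def)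
  then show ?thesis
    unfolding invertible_left_inverse matrix_left_invertible_ker by blast
qed

lemma matrix_inv_mult:
  assumes "invertible M"
  shows "M ** matrix_inv M = mat 1" "matrix_inv M ** M = mat 1"
  using assms someI_ex[of "\<lambda>N. M ** N = mat 1 \<and> N ** M = mat 1"]
  unfolding invertible_def matrix_inv_def by blast+

lemma ctranspose_mult: "ctranspose (M ** N) = ctranspose N ** ctranspose M"
  by (simp add: vec_eq_iff ctranspose_def transpose_def matrix_matrix_mult_def mult.commute)

lemma ctranspose_pencil: "ctranspose (pencil E A z) = pencil (transpose E) (transpose A) (cnj z)"
  by (simp add: vec_eq_iff ctranspose_def pencil_def transpose_def)

lemma ctranspose_matrix_inv:
  assumes "invertible M"
  shows "ctranspose (matrix_inv M) = matrix_inv (ctranspose M)"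
proof -
  have one: "ctranspose (mat 1) = mat 1"
    by (simp add: vec_eq_iff ctranspose_def transpose_def mat_def)
  have inv: "ctranspose M ** ctranspose (matrix_inv M) = mat 1"
    "ctranspose (matrix_inv M) ** ctranspose M = mat 1"
    using matrix_inv_mult[OF assms] by (simp_all flip: ctranspose_mult add: one)
  then have "matrix_inv (ctranspose M) ** ctranspose M = mat 1"
    by (intro matrix_inv_mult) (auto simp: invertible_def)
  then show ?thesis
    using inv(1) by (metis matrix_mul_assoc matrix_mul_lid matrix_mul_rid)
qed

lemma quad_Q_eq_sum:
  assumes "\<And>l. \<not> pencil_eigenvalue E A (\<i> * complex_of_real (\<omega> l))"
  shows "quad_Q E A C \<omega> \<phi> =
    (\<Sum>l\<in>UNIV. (\<phi> l)\<^sup>2 *\<^sub>R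
      (matrix_inv (pencil (transpose E) (transpose A) (- \<i> * complex_of_real (\<omega> l)))
        ** cmat (transpose C) ** cmat C ** matrix_inv (pencil E A (\<i> * complex_of_real (\<omega> l)))))"
proof -
  define X where "X l = cmat C ** matrix_inv (pencil E A (\<i> * complex_of_real (\<omega> l)))" for l
  have "ctranspose (cmat C) = cmat (transpose C)"
    by (simp add: vec_eq_iff ctranspose_def transpose_def)
  then have X: "matrix_inv (pencil (transpose E) (transpose A) (- \<i> * complex_of_real (\<omega> l)))
        ** cmat (transpose C) ** cmat C ** matrix_inv (pencil E A (\<i> * complex_of_real (\<omega> l)))
      = ctranspose (X l) ** X l" for l
    using ctranspose_matrix_inv[OF invertible_pencil[OF assms[of l]]]
    by (simp add: X_def ctranspose_mult ctranspose_pencil matrix_mul_assoc)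
  have L: "quad_L E A C \<omega> \<phi> = ctranspose (\<chi> l. row 1 (\<phi> l *\<^sub>R X l))"
    by (simp add: quad_L_def quad_Lstar_def X_def)
  show ?thesis
    unfolding X quad_Q_def L
    by (simp add: vec_eq_iff ctranspose_def transpose_def matrix_matrix_mult_def row_def
        sum_component power2_eq_square scaleR_conv_of_real[where 'a = complex] mult_ac)
qed

end

theory Submission
  imports Defs
begin

text \<open>Since \<open>quad_Q\<close> is L L^* with L = \<open>quad_L\<close>, the projection
  matrix W = L (L^* E V) is L times \<open>data_L\<close>. Hence W^* = \<open>data_L\<close>^* L^*,
  and in each product with W^* the trailing factor L^* meets A V, E V or B, which gives
  \<open>data_M\<close>, \<open>data_L\<close> or \<open>data_V\<close>. The output matrix involves
  no W and is already data.\<close>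

lemma ctranspose_ctranspose [simp]: "ctranspose (ctranspose M) = M"
  by (simp add: vec_eq_iff ctranspose_def transpose_def)

text \<open>This carries the theorem: L^* is split off on the right, where it can be absorbed into
  the data.\<close>

lemma ctranspose_proj_W:
  "ctranspose (proj_W E A B C \<omega> \<phi> \<eta>) =
    ctranspose (data_L E A B C \<omega> \<phi> \<eta>) ** ctranspose (quad_L E A C \<omega> \<phi>)"
  by (simp add: proj_W_def quad_Q_def data_L_def ctranspose_mult matrix_mul_assoc)

theorem theorem3p4:
  fixes E A :: "real ^ 'n ^ 'n"
    and B :: "real ^ 1 ^ 'n"
    and C :: "real ^ 'n ^ 1"
    and \<omega> \<phi> :: "'q::finite \<Rightarrow> real"
    and \<eta> :: "nat \<Rightarrow> 'r::finite \<Rightarrow> complex"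
    and k :: nat
  assumes "invertible E"
    and "\<And>z. pencil_eigenvalue E A z \<Longrightarrow> Re z < 0"
    and "\<And>j. \<not> pencil_eigenvalue E A (\<eta> k j)"
  shows "reduced_A E A B C \<omega> \<phi> (\<eta> k)
           = ctranspose (data_L E A B C \<omega> \<phi> (\<eta> k)) ** data_M E A B C \<omega> \<phi> (\<eta> k)
       \<and> reduced_E E A B C \<omega> \<phi> (\<eta> k)
           = ctranspose (data_L E A B C \<omega> \<phi> (\<eta> k)) ** data_L E A B C \<omega> \<phi> (\<eta> k)
       \<and> reduced_B E A B C \<omega> \<phi> (\<eta> k)
           = ctranspose (data_L E A B C \<omega> \<phi> (\<eta> k)) ** data_V E A B C \<omega> \<phi>
       \<and> reduced_C E A B C (\<eta> k) = data_W E A B C (\<eta> k)"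
  unfolding reduced_A_def reduced_E_def reduced_B_def reduced_C_def ctranspose_proj_W
  by (simp add: data_L_def data_M_def data_V_def data_W_def matrix_mul_assoc)

end
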